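(* For any two Cauchy sequences of rational numbers $\{x^{(n)}\}_{n\in\mathbb N}$, $\{y^{(n)}\}_{n\in\mathbb N}$, $$\{x^{(n)}\}_{n\in\mathbb N}\approx\{y^{(n)}\}_{n\in\mathbb N}\iff\kappa(\{x^{(n)}\}_{n\in\mathbb N})=\kappa(\{y^{(n)}\}_{n\in\mathbb N}).$$
   Context: $\mathbb N=\{1,2,3,\dots\}$ and $\mathcal Z_{10}=\{0,1,\dots,9\}$. $\mathcal R$ is the set of all formal decimals $x=x_0.x_1x_2x_3\cdots$ with $x_0\in\mathbb Z$ and $x_k\in\mathcal Z_{10}$ for $k\in\mathbb N$; two elements are equal iff all their digits agree. For $k\in\mathbb N$, $[x]_k=\sum_{i=0}^k x_i10^{-i}\in\mathbb Q$. Order on $\mathcal R$: $x\preceq y$ iff $[x]_k\le [y]_k$ for all $k\in\mathbb N$. Every nonempty bounded above (below) subset of $(\mathcal R,\preceq)$ has a supremum (infimum). $x\sim y$ ("no gap") means that there is no $z\in\mathcal R\setminus\{x,y\}$ lying strictly between $x$ and $y$ with respect to $\preceq$; $\sim$ is an equivalence relation, and $[x]$ denotes the class of $x$ in $\mathcal R/\sim$. $\mathbb Q$ is regarded as a subset of $\mathcal R$ via long division: $\alpha=q/p$ ($p\in\mathbb N$, $q\in\mathbb Z$) is identified with $\alpha_0.\alpha_1\alpha_2\cdots$, where $\alpha_0=\lfloor q/p\rfloor$, $\beta_0=q-\alpha_0p$, $\alpha_{k+1}=\lfloor 10\beta_k/p\rfloor$, $\beta_{k+1}=10\beta_k-\alpha_{k+1}p$.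 For a bounded sequence $\{x^{(n)}\}_{n\in\mathbb N}$ in $\mathcal R$: $\overline{\mathrm{LIMIT}}(\{x^{(n)}\})=\inf\{\sup\{x^{(k)}: k\ge n\}: n\in\mathbb N\}$ and $\underline{\mathrm{LIMIT}}(\{x^{(n)}\})=\sup\{\inf\{x^{(k)}: k\ge n\}: n\in\mathbb N\}$, with $\sup$, $\inf$ taken in $(\mathcal R,\preceq)$. A sequence of rational numbers $\{x^{(n)}\}_{n\in\mathbb N}$ is Cauchy if for every rational $\epsilon>0$ there is $N\in\mathbb N$ such that $|x^{(m)}-x^{(n)}|<\epsilon$ for all $m,n\ge N$. $\mathbf{CR}$ is the set of all such sequences. $\{x^{(n)}\}\approx\{y^{(n)}\}$ means: for every rational $\epsilon>0$ there is $N\in\mathbb N$ such that $|x^{(n)}-y^{(n)}|<\epsilon$ for all $n\ge N$. For every Cauchy sequence of rationals the lower and upper limits are $\sim$-equivalent, and $\kappa:\mathbf{CR}\to\mathcal R/\sim$ is defined by $\kappa(\{x^{(n)}\})=[\underline{\mathrm{LIMIT}}(\{x^{(n)}\})]=[\overline{\mathrm{LIMIT}}(\{x^{(n)}\})]$. *)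

theory Defs
  imports Complex_Main
begin

text \<open>Formal decimals \<open>x\<^sub>0.x\<^sub>1x\<^sub>2\<dots>\<close>, represented by their digit sequence. Position \<open>0\<close> holds the
  (arbitrary) integer part; the remaining digits always count
  upwards from it, so integer part \<open>-1\<close> followed by \<open>5, 0, 0, \<dots>\<close> stands for \<open>-1 + 5/10\<close>. Nothing identifies tails of nines with tails of zeros.\<close>

typedef decimal = "{x :: nat \<Rightarrow> int. \<forall>k\<ge>1. x k \<in> {0..9}}"
  morphisms digit Decimal
proof
  show "(\<lambda>_. 0) \<in> {x :: nat \<Rightarrow> int. \<forall>k\<ge>1. x k \<in> {0..9}}" by simp
qed

definition trunc :: "decimal \<Rightarrow> nat \<Rightarrow> rat" where
  "trunc x k = (\<Sum>i=0..k. of_int (digit x i) / 10 ^ i)"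

lemma digit_range: "0 \<le> digit x (Suc k)" "digit x (Suc k) \<le> 9"
  using digit[of x] by auto

text \<open>Auxiliary: the truncation scaled to an integer, \<open>10\<^sup>k\<close> times \<open>trunc x k\<close>.\<close>

primrec itrunc :: "decimal \<Rightarrow> nat \<Rightarrow> int" where
  "itrunc x 0 = digit x 0"
| "itrunc x (Suc k) = 10 * itrunc x k + digit x (Suc k)"

lemma trunc_itrunc: "trunc x k = of_int (itrunc x k) / 10 ^ k"
  by (induction k) (auto simp: trunc_def field_simps)

lemma trunc_le_iff: "trunc x k \<le> trunc y k \<longleftrightarrow> itrunc x k \<le> itrunc y k"
  by (simp add: trunc_itrunc divide_le_cancel)

lemma itrunc_Suc_div: "itrunc x (Suc k) div 10 = itrunc x k"
  using digit_range[of x k] by auto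

lemma digit_Suc_itrunc: "digit x (Suc k) = itrunc x (Suc k) mod 10"
proof -
  have "digit x (Suc k) mod 10 = digit x (Suc k)"
    using digit_range[of x k] by (intro mod_pos_pos_trivial) auto
  then show ?thesis by simp
qed

lemma itrunc_le_SucD: "itrunc x (Suc k) \<le> itrunc y (Suc k) \<Longrightarrow> itrunc x k \<le> itrunc y k"
  by (metis itrunc_Suc_div zdiv_mono1 zero_less_numeral)

lemma itrunc_less_Suc: "itrunc x k < itrunc y k \<Longrightarrow> itrunc x (Suc k) < itrunc y (Suc k)"
  using digit_range[of x k] digit_range[of y k] by simp

lemma itrunc_less_mono: "itrunc x k < itrunc y k \<Longrightarrow> k \<le> l \<Longrightarrow> itrunc x l < itrunc y l"
proof (induction l)
  case (Suc l)
  then show ?case using itrunc_less_Suc[of x l y] by (cases "k = Suc l") auto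
qed simp

lemma decimal_eqI:
  assumes "\<And>k. itrunc x k = itrunc y k"
  shows "x = y"
proof -
  have "digit x k = digit y k" for k
    using assms by (cases k) (metis itrunc.simps(1), metis digit_Suc_itrunc)
  then show ?thesis by (metis digit_inject ext)
qed

text \<open>Any compatible sequence of scaled truncations comes from a decimal.\<close>

lemma itrunc_surj:
  assumes "\<And>k. M (Suc k) div 10 = M k"
  obtains s where "\<And>k. itrunc s k = M k"
proof -
  define f where "f k = (case k of 0 \<Rightarrow> M 0 | Suc j \<Rightarrow> M (Suc j) mod 10)" for k
  have "f k \<in> {0..9}" if "k \<ge> 1" for k
  proof -
    obtain j where "k = Suc j" using \<open>k \<ge> 1\<close> not0_implies_Suc by force
    moreover have "0 \<le> M (Suc j) mod 10" "M (Suc j) mod 10 < 10" by auto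
    ultimately show ?thesis unfolding f_def by simp
  qed
  then have d: "digit (Decimal f) = f" by (intro Decimal_inverse) auto
  have "itrunc (Decimal f) k = M k" for k
  proof (induction k)
    case (Suc k)
    have "digit (Decimal f) (Suc k) = M (Suc k) mod 10" by (subst d) (simp add: f_def)
    then show ?case using Suc assms[of k] div_mult_mod_eq[of "M (Suc k)" 10] by simp
  next
    case 0
    show ?case by (simp only: itrunc.simps d) (simp add: f_def)
  qed
  then show ?thesis using that by blast
qed

instantiation decimal :: linorder
begin

definition less_eq_decimal :: "decimal \<Rightarrow> decimal \<Rightarrow> bool" where
  "x \<le> y \<longleftrightarrow> (\<forall>k\<ge>1. trunc x k \<le> trunc y k)"

definition less_decimal :: "decimal \<Rightarrow> decimal \<Rightarrow> bool" where
  "x < y \<longleftrightarrow> x \<le> y \<and> x \<noteq> (y :: decimal)"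

lemma decimal_le_iff: "x \<le> y \<longleftrightarrow> (\<forall>k. itrunc x k \<le> itrunc y k)"
proof
  assume "x \<le> y"
  then have *: "itrunc x k \<le> itrunc y k" if "k \<ge> 1" for k
    using that by (auto simp: less_eq_decimal_def trunc_le_iff)
  show "\<forall>k. itrunc x k \<le> itrunc y k"
  proof
    show "itrunc x k \<le> itrunc y k" for k
      by (rule itrunc_le_SucD, rule *) simp
  qed
qed (auto simp: less_eq_decimal_def trunc_le_iff)

instance
proof
  fix x y z :: decimal
  show antisym: "x = y" if "x \<le> y" "y \<le> x"
    using that by (intro decimal_eqI) (auto simp: decimal_le_iff intro: order.antisym)
  show "x < y \<longleftrightarrow> x \<le> y \<and> \<not> y \<le> x"
    unfolding less_decimal_def decimal_le_iff by (metis decimal_eqI order.antisym order_refl)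
  show "x \<le> x" by (simp add: decimal_le_iff)
  show "x \<le> z" if "x \<le> y" "y \<le> z"
    using that by (meson decimal_le_iff order_trans)
  show "x \<le> y \<or> y \<le> x"
  proof (rule ccontr)
    assume "\<not> (x \<le> y \<or> y \<le> x)"
    then obtain k l where "itrunc y k < itrunc x k" "itrunc x l < itrunc y l"
      by (meson decimal_le_iff not_le)
    then show False
      using itrunc_less_mono[of y k x "max k l"] itrunc_less_mono[of x l y "max k l"]
      by (meson max.cobounded1 max.cobounded2 order_less_asym)
  qed
qed

end

lemma decimal_lub_exists:
  fixes A :: "decimal set"
  assumes "A \<noteq> {}" "bdd_above A"
  shows "\<exists>s. (\<forall>a\<in>A. a \<le> s) \<and> (\<forall>u. (\<forall>a\<in>A. a \<le> u) \<longrightarrow> s \<le> u)"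
proof -
  obtain b where b: "\<And>a. a \<in> A \<Longrightarrow> a \<le> b" using assms(2) by (auto simp: bdd_above_def)
  have "\<exists>m\<in>A. \<forall>a\<in>A. itrunc a k \<le> itrunc m k" for k
  proof -
    obtain a0 where a0: "a0 \<in> A" using assms(1) by blast
    define I where "I = (\<lambda>a. itrunc a k) ` A \<inter> {itrunc a0 k..}"
    have "I \<subseteq> {itrunc a0 k..itrunc b k}" using b by (auto simp: I_def decimal_le_iff)
    then have fin: "finite I" by (rule finite_subset) simp
    have "I \<noteq> {}" using a0 by (auto simp: I_def)
    then have "Max I \<in> I" using fin by (rule Max_in[rotated])
    then obtain m where m: "m \<in> A" "itrunc m k = Max I" "itrunc a0 k \<le> Max I" 
      unfolding I_def by auto
    have "itrunc a k \<le> Max I" if "a \<in> A" for a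
    proof (cases "itrunc a0 k \<le> itrunc a k")
      case True
      then have "itrunc a k \<in> I" using that by (simp add: I_def)
      then show ?thesis using fin by simp
    next
      case False
      then show ?thesis using m(3) by linarith
    qed
    then show ?thesis using m(1,2) by metis
  qed
  then obtain m where m: "\<And>k. m k \<in> A" "\<And>k a. a \<in> A \<Longrightarrow> itrunc a k \<le> itrunc (m k) k"
    by metis
  have "itrunc (m (Suc k)) (Suc k) div 10 = itrunc (m k) k" for k
  proof (rule antisym)
    show "itrunc (m (Suc k)) (Suc k) div 10 \<le> itrunc (m k) k"
      using m itrunc_Suc_div by metis
    have "itrunc (m k) (Suc k) div 10 \<le> itrunc (m (Suc k)) (Suc k) div 10"
      using m(2)[OF m(1)] by (rule zdiv_mono1) simp
    then show "itrunc (m k) k \<le> itrunc (m (Suc k)) (Suc k) div 10"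
      by (metis itrunc_Suc_div)
  qed
  then obtain s where "\<And>k. itrunc s k = itrunc (m k) k"
    using itrunc_surj[of "\<lambda>k. itrunc (m k) k"] by blast
  then show ?thesis using m by (intro exI[of _ s]) (auto simp: decimal_le_iff)
qed

lemma decimal_lub_ex1:
  fixes A :: "decimal set"
  assumes "A \<noteq> {}" "bdd_above A"
  shows "\<exists>!s. (\<forall>a\<in>A. a \<le> s) \<and> (\<forall>u. (\<forall>a\<in>A. a \<le> u) \<longrightarrow> s \<le> u)"
proof (rule ex_ex1I)
  show "\<exists>s. (\<forall>a\<in>A. a \<le> s) \<and> (\<forall>u. (\<forall>a\<in>A. a \<le> u) \<longrightarrow> s \<le> u)"
    by (rule decimal_lub_exists[OF assms])
qed (blast intro: order.antisym)

lemma decimal_glb_ex1: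
  fixes A :: "decimal set"
  assumes "A \<noteq> {}" "bdd_below A"
  shows "\<exists>!s. (\<forall>a\<in>A. s \<le> a) \<and> (\<forall>u. (\<forall>a\<in>A. u \<le> a) \<longrightarrow> u \<le> s)"
proof (rule ex_ex1I)
  define L where "L = {l. \<forall>a\<in>A. l \<le> a}"
  have "L \<noteq> {}" using assms(2) by (auto simp: L_def bdd_below_def)
  moreover have "bdd_above L" using assms(1) by (auto simp: L_def bdd_above_def)
  ultimately obtain s where "\<forall>l\<in>L. l \<le> s" "\<forall>u. (\<forall>l\<in>L. l \<le> u) \<longrightarrow> s \<le> u"
    using decimal_lub_exists[of L] by blast
  then have "(\<forall>a\<in>A. s \<le> a) \<and> (\<forall>u. (\<forall>a\<in>A. u \<le> a) \<longrightarrow> u \<le> s)"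
    unfolding L_def by simp
  then show "\<exists>s. (\<forall>a\<in>A. s \<le> a) \<and> (\<forall>u. (\<forall>a\<in>A. u \<le> a) \<longrightarrow> u \<le> s)" ..
qed (blast intro: order.antisym)

instantiation decimal :: conditionally_complete_linorder
begin

definition sup_decimal :: "decimal \<Rightarrow> decimal \<Rightarrow> decimal" where
  "sup_decimal = max"

definition inf_decimal :: "decimal \<Rightarrow> decimal \<Rightarrow> decimal" where
  "inf_decimal = min"

definition Sup_decimal :: "decimal set \<Rightarrow> decimal" where
  "Sup (A :: decimal set) = (THE s. (\<forall>a\<in>A. a \<le> s) \<and> (\<forall>u. (\<forall>a\<in>A. a \<le> u) \<longrightarrow> s \<le> u))"

definition Inf_decimal :: "decimal set \<Rightarrow> decimal" where
  "Inf (A :: decimal set) = (THE s. (\<forall>a\<in>A. s \<le> a) \<and> (\<forall>u. (\<forall>a\<in>A. u \<le> a) \<longrightarrow> u \<le> s))"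

instance
proof
  fix x y z :: decimal and A :: "decimal set"
  show "inf x y \<le> x" "inf x y \<le> y" "x \<le> y \<Longrightarrow> x \<le> z \<Longrightarrow> x \<le> inf y z"
    "x \<le> sup x y" "y \<le> sup x y" "y \<le> x \<Longrightarrow> z \<le> x \<Longrightarrow> sup y z \<le> x"
    by (auto simp: inf_decimal_def sup_decimal_def)
  note Sup = theI'[OF decimal_lub_ex1, folded Sup_decimal_def]
  note Inf = theI'[OF decimal_glb_ex1, folded Inf_decimal_def]
  show "Inf A \<le> x" if "x \<in> A" "bdd_below A"
    using Inf[OF _ that(2)] that(1) by blast
  show "z \<le> Inf A" if "A \<noteq> {}" "\<And>a. a \<in> A \<Longrightarrow> z \<le> a"
    using Inf[OF that(1) bdd_belowI[OF that(2)]] that(2) by blast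
  show "x \<le> Sup A" if "x \<in> A" "bdd_above A"
    using Sup[OF _ that(2)] that(1) by blast
  show "Sup A \<le> z" if "A \<noteq> {}" "\<And>a. a \<in> A \<Longrightarrow> a \<le> z"
    using Sup[OF that(1) bdd_aboveI[OF that(2)]] that(2) by blast
qed

end

definition no_gap :: "decimal \<Rightarrow> decimal \<Rightarrow> bool" where
  "no_gap x y \<longleftrightarrow> \<not> (\<exists>z. z \<noteq> x \<and> z \<noteq> y \<and> (x < z \<and> z < y \<or> y < z \<and> z < x))"

definition gap_class :: "decimal \<Rightarrow> decimal set" where
  "gap_class x = {(u, v). no_gap u v} `` {x}"

text \<open>Long division of \<open>q\<close> by \<open>p > 0\<close>. On integers \<open>div\<close> rounds towards minus infinity, so it
  is the floor of the quotient.\<close>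

primrec ldiv_rem :: "int \<Rightarrow> int \<Rightarrow> nat \<Rightarrow> int" where
  "ldiv_rem q p 0 = q - (q div p) * p"
| "ldiv_rem q p (Suc k) = 10 * ldiv_rem q p k - (10 * ldiv_rem q p k div p) * p"

fun ldiv_digit :: "int \<Rightarrow> int \<Rightarrow> nat \<Rightarrow> int" where
  "ldiv_digit q p 0 = q div p"
| "ldiv_digit q p (Suc k) = 10 * ldiv_rem q p k div p"

definition decimal_of_rat :: "rat \<Rightarrow> decimal" where
  "decimal_of_rat r = (case quotient_of r of (q, p) \<Rightarrow> Decimal (ldiv_digit q p))"

lemma ldiv_rem_range: "0 < p \<Longrightarrow> 0 \<le> ldiv_rem q p k \<and> ldiv_rem q p k < p"
  by (cases k) (simp_all add: minus_div_mult_eq_mod)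

lemma digit_decimal_of_rat:
  assumes "quotient_of r = (q, p)"
  shows "digit (decimal_of_rat r) = ldiv_digit q p"
proof -
  have p: "0 < p" using assms by (rule quotient_of_denom_pos)
  have "ldiv_digit q p k \<in> {0..9}" if "k \<ge> 1" for k
  proof -
    obtain j where j: "k = Suc j" using \<open>k \<ge> 1\<close> not0_implies_Suc by force
    have "0 \<le> 10 * ldiv_rem q p j div p"
      using ldiv_rem_range[OF p, of q j] p by (simp add: pos_imp_zdiv_nonneg_iff)
    moreover have "10 * ldiv_rem q p j div p < 10"
      
    proof -
      have "10 * ldiv_rem q p j div p * p \<le> 10 * ldiv_rem q p j"
        using p by (simp add: minus_mod_eq_div_mult[symmetric])
      also have "\<dots> < 10 * p" using ldiv_rem_range[OF p, of q j] by simp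
      finally show ?thesis using p by (simp only: mult_less_cancel_right_pos)
    qed
    ultimately show ?thesis using j by simp
  qed
  then show ?thesis using assms by (simp add: decimal_of_rat_def Decimal_inverse)
qed

text \<open>The embedding does not depend on the fraction chosen to represent the rational.\<close>

lemma digit_decimal_of_rat_fraction:
  assumes "0 < p"
  shows "digit (decimal_of_rat (of_int q / of_int p)) = ldiv_digit q p"
proof -
  obtain q' p' where qp: "quotient_of (of_int q / of_int p) = (q', p')" by fastforce
  have p': "0 < p'" using qp by (rule quotient_of_denom_pos)
  have "(of_int q / of_int p :: rat) = of_int q' / of_int p'"
    using qp by (rule quotient_of_div)
  then have "(of_int (q * p') :: rat) = of_int (q' * p)"
    using assms p' by (simp add: field_simps)
  then have eq: "q * p' = q' * p" by (simp only: of_int_eq_iff)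
  have div_eq: "a div p = b div p'" if "a * p' = b * p" for a b
  proof -
    have "a div p = (a * p') div (p * p')" using p' by simp
    also have "\<dots> = (b * p) div (p' * p)" by (simp only: that mult.commute)
    also have "\<dots> = b div p'" using assms by simp
    finally show ?thesis .
  qed
  have rem: "ldiv_rem q p k * p' = ldiv_rem q' p' k * p" for k
  proof (induction k)
    case 0
    then show ?case using div_eq[OF eq] eq by (simp add: algebra_simps)
  next
    case (Suc k)
    then have "(10 * ldiv_rem q p k) * p' = (10 * ldiv_rem q' p' k) * p" by simp
    then show ?case using div_eq[of "10 * ldiv_rem q p k" "10 * ldiv_rem q' p' k"]
      by (simp add: algebra_simps)
  qed
  have "ldiv_digit q p k = ldiv_digit q' p' k" for k
  proof (cases k)
    case 0
    then show ?thesis using div_eq[OF eq] by simp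
  next
    case (Suc j)
    have "(10 * ldiv_rem q p j) * p' = (10 * ldiv_rem q' p' j) * p" using rem[of j] by simp
    then show ?thesis using div_eq Suc by simp
  qed
  then show ?thesis using digit_decimal_of_rat[OF qp] by auto
qed

text \<open>Sequences are indexed by the positive naturals: the value at \<open>0\<close> is never inspected.\<close>

definition upper_LIMIT :: "(nat \<Rightarrow> decimal) \<Rightarrow> decimal" where
  "upper_LIMIT x = Inf {Sup {x k | k. k \<ge> n} | n. n \<ge> 1}"

definition lower_LIMIT :: "(nat \<Rightarrow> decimal) \<Rightarrow> decimal" where
  "lower_LIMIT x = Sup {Inf {x k | k. k \<ge> n} | n. n \<ge> 1}"

definition CR :: "(nat \<Rightarrow> rat) set" where
  "CR = {x. \<forall>\<epsilon>>0. \<exists>N\<ge>1. \<forall>m\<ge>N. \<forall>n\<ge>N. \<bar>x m - x n\<bar> < \<epsilon>}"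

definition seq_approx :: "(nat \<Rightarrow> rat) \<Rightarrow> (nat \<Rightarrow> rat) \<Rightarrow> bool" where
  "seq_approx x y \<longleftrightarrow> (\<forall>\<epsilon>>0. \<exists>N\<ge>1. \<forall>n\<ge>N. \<bar>x n - y n\<bar> < \<epsilon>)"

text \<open>For Cauchy sequences the lower and the upper limit lie in the same class, so \<open>kappa\<close> could
  equally be defined with \<open>upper_LIMIT\<close>.\<close>

definition kappa :: "(nat \<Rightarrow> rat) \<Rightarrow> decimal set" where
  "kappa x = gap_class (lower_LIMIT (\<lambda>n. decimal_of_rat (x n)))"

end

theory Submission
  imports Defs
begin

text \<open>Every decimal has a real value, monotone in the decimal, and two decimals have no gap between
  them iff their values agree: a rational separates distinct values, while of three distinct
  decimals of the same value the middle one would have to end both in zeros and in nines. The lower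
  limit of a Cauchy sequence of rationals is squeezed between the expansions of rationals close to
  the tail of the sequence, so its value is the real limit of the sequence. Both sides of the
  equivalence thus say that the two real limits agree.\<close>

definition decimal_value :: "decimal \<Rightarrow> real" where
  "decimal_value x = (SUP k. of_int (itrunc x k) / 10 ^ k)"

lemma itrunc_incseq: "incseq (\<lambda>k. of_int (itrunc x k) / 10 ^ k :: real)"
proof (rule incseq_SucI)
  show "of_int (itrunc x k) / 10 ^ k \<le> (of_int (itrunc x (Suc k)) / 10 ^ Suc k :: real)" for k
    using digit_range(1)[of x k] by (simp add: field_simps)
qed

text \<open>A new digit contributes at most 9 units of the new last place, and the extra unit makes
  at most 10 of them, that is one unit of the old last place. These upper approximations keep the
  supremum in \<open>decimal_value\<close> finite.\<close>

lemma itrunc_succ_decseq: "decseq (\<lambda>k. (of_int (itrunc x k) + 1) / 10 ^ k :: real)"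
proof (rule decseq_SucI)
  fix k
  have "real_of_int (digit x (Suc k)) \<le> 9"
    using digit_range(2)[of x k] by linarith
  then show "(of_int (itrunc x (Suc k)) + 1) / 10 ^ Suc k \<le> ((of_int (itrunc x k) + 1) / 10 ^ k :: real)"
    by (simp add: field_simps)
qed

lemma itrunc_le_itrunc_succ:
  "of_int (itrunc x k) / 10 ^ k \<le> ((of_int (itrunc x l) + 1) / 10 ^ l :: real)"
proof -
  \<comment> \<open>Positions k and l are compared through a common later position.\<close>
  have "of_int (itrunc x k) / 10 ^ k \<le> (of_int (itrunc x (max k l)) / 10 ^ max k l :: real)"
    using itrunc_incseq[of x] by (simp add: incseq_def)
  also have "\<dots> \<le> (of_int (itrunc x (max k l)) + 1) / 10 ^ max k l"
    by (simp add: divide_right_mono)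
  also have "\<dots> \<le> (of_int (itrunc x l) + 1) / 10 ^ l"
    using itrunc_succ_decseq[of x] by (simp add: decseq_def)
  finally show ?thesis .
qed

lemma decimal_value_lower: "of_int (itrunc x k) \<le> decimal_value x * 10 ^ k"
proof -
  have "bdd_above (range (\<lambda>k. of_int (itrunc x k) / 10 ^ k :: real))"
    using itrunc_le_itrunc_succ[of x _ 0] by (intro bdd_aboveI2)
  then have "of_int (itrunc x k) / 10 ^ k \<le> decimal_value x"
    unfolding decimal_value_def by (rule cSUP_upper[rotated]) simp
  then show ?thesis by (simp add: field_simps)
qed

text \<open>Equality cannot be excluded: it occurs when all digits after position k are
  nines.\<close>

lemma decimal_value_upper: "decimal_value x * 10 ^ k \<le> of_int (itrunc x k) + 1"
proof -
  have "decimal_value x \<le> (of_int (itrunc x k) + 1) / 10 ^ k"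
    unfolding decimal_value_def by (rule cSUP_least) (simp_all add: itrunc_le_itrunc_succ)
  then show ?thesis by (simp add: field_simps)
qed

lemma decimal_value_mono:
  assumes "x \<le> y"
  shows "decimal_value x \<le> decimal_value y"
  unfolding decimal_value_def
proof (rule cSUP_mono)
  show "bdd_above (range (\<lambda>k. of_int (itrunc y k) / 10 ^ k :: real))"
    using itrunc_le_itrunc_succ[of y _ 0] by (intro bdd_aboveI2)
  show "\<exists>l\<in>UNIV. of_int (itrunc x k) / 10 ^ k \<le> (of_int (itrunc y l) / 10 ^ l :: real)" for k
    using assms by (intro bexI[of _ k]) (simp_all add: decimal_le_iff divide_right_mono)
qed simp

lemma decimal_less_if_value_less: "decimal_value x < decimal_value y \<Longrightarrow> x < y"
  using decimal_value_mono[of y x] by (meson not_le)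

lemma decimal_value_eqI:
  assumes "\<And>k. of_int (itrunc x k) \<le> v * 10 ^ k" "\<And>k. v * 10 ^ k \<le> of_int (itrunc x k) + 1"
  shows "decimal_value x = v"
proof (rule ccontr)
  assume "decimal_value x \<noteq> v"
  \<comment> \<open>From position k on, one unit of the last place is smaller than the distance of
    the two numbers; but both lie between \<open>itrunc x k\<close> and
    \<open>itrunc x k + 1\<close> after scaling by \<open>10 ^ k\<close>.\<close>
  then obtain k where "(1 / 10) ^ k < \<bar>decimal_value x - v\<bar>"
    using real_arch_pow_inv[of "\<bar>decimal_value x - v\<bar>" "1 / 10"] by auto
  then have "1 < \<bar>decimal_value x - v\<bar> * 10 ^ k" by (simp add: field_simps)
  also have "\<dots> = \<bar>decimal_value x * 10 ^ k - v * 10 ^ k\<bar>"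
    by (simp add: abs_mult flip: left_diff_distrib)
  also have "\<dots> \<le> 1"
    using assms[of k] decimal_value_lower[of x k] decimal_value_upper[of x k] by linarith
  finally show False by simp
qed

text \<open>The invariant of long division: after k steps the integer formed by the digits is the
  quotient of \<open>q * 10 ^ k\<close> by \<open>p\<close>, and \<open>ldiv_rem q p k\<close> is
  what is left over.\<close>

lemma itrunc_decimal_of_rat:
  assumes "quotient_of r = (q, p)"
  shows "q * 10 ^ k = itrunc (decimal_of_rat r) k * p + ldiv_rem q p k"
proof (induction k)
  case 0
  then show ?case by (simp add: digit_decimal_of_rat[OF assms])
next
  case (Suc k)
  have "itrunc (decimal_of_rat r) (Suc k) * p + ldiv_rem q p (Suc k) =
    10 * (itrunc (decimal_of_rat r) k * p + ldiv_rem q p k)"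
    by (simp add: digit_decimal_of_rat[OF assms] algebra_simps)
  then show ?case using Suc by simp
qed

lemma decimal_value_of_rat: "decimal_value (decimal_of_rat r) = of_rat r"
proof -
  obtain q p where qp: "quotient_of r = (q, p)" by fastforce
  have p: "0 < p" using qp by (rule quotient_of_denom_pos)
  have r: "real_of_rat r = of_int q / of_int p"
    using quotient_of_div[OF qp] by (simp add: of_rat_divide)
  have scaled: "of_int q * 10 ^ k =
    (of_int (itrunc (decimal_of_rat r) k) * of_int p + of_int (ldiv_rem q p k) :: real)" for k
    using arg_cong[OF itrunc_decimal_of_rat[OF qp, of k], of real_of_int] by simp
  have rem: "0 \<le> real_of_int (ldiv_rem q p k)" "real_of_int (ldiv_rem q p k) \<le> of_int p" for k
    using ldiv_rem_range[OF p, of q k] by auto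
  show ?thesis
  proof (rule decimal_value_eqI)
    fix k
    show "of_int (itrunc (decimal_of_rat r) k) \<le> real_of_rat r * 10 ^ k"
      using p scaled[of k] rem[of k] by (simp add: r field_simps)
    show "real_of_rat r * 10 ^ k \<le> of_int (itrunc (decimal_of_rat r) k) + 1"
      using p scaled[of k] rem[of k] by (simp add: r field_simps)
  qed
qed

lemma decimal_of_rat_strict_mono: "r < s \<Longrightarrow> decimal_of_rat r < decimal_of_rat s"
  by (rule decimal_less_if_value_less) (simp add: decimal_value_of_rat of_rat_less)

text \<open>Once the truncations differ, they differ by at least 1 at every later position. The
  common scaled value is at most \<open>itrunc x l + 1\<close> and at least
  \<open>itrunc y l\<close>, so both inequalities are equalities: \<open>y\<close> continues with
  zeros and \<open>x\<close> with nines.\<close>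

lemma itrunc_eventually_if_value_eq:
  assumes "x < y" "decimal_value x = decimal_value y"
  obtains k where "\<And>l. k \<le> l \<Longrightarrow>
    of_int (itrunc y l) = decimal_value y * 10 ^ l \<and> itrunc x l + 1 = itrunc y l"
proof -
  obtain k where k: "itrunc x k < itrunc y k"
    using assms(1) by (metis decimal_le_iff not_le)
  have "of_int (itrunc y l) = decimal_value y * 10 ^ l \<and> itrunc x l + 1 = itrunc y l"
    if "k \<le> l" for l
    using itrunc_less_mono[OF k that] decimal_value_upper[of x l] decimal_value_lower[of y l]
      assms(2) by auto
  then show ?thesis by (rule that)
qed

lemma value_less_if_between:
  assumes "x < z" "z < y"
  shows "decimal_value x < decimal_value y"
proof (rule ccontr)
  assume "\<not> ?thesis"
  then have eq: "decimal_value x = decimal_value z" "decimal_value z = decimal_value y"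
    using assms[THEN less_imp_le, THEN decimal_value_mono] by linarith+
  obtain k l where
    k: "\<And>n. k \<le> n \<Longrightarrow> of_int (itrunc z n) = decimal_value z * 10 ^ n \<and> itrunc x n + 1 = itrunc z n"
    and l: "\<And>n. l \<le> n \<Longrightarrow> of_int (itrunc y n) = decimal_value y * 10 ^ n \<and> itrunc z n + 1 = itrunc y n"
    using itrunc_eventually_if_value_eq[OF assms(1) eq(1)]
      itrunc_eventually_if_value_eq[OF assms(2) eq(2)] by metis
  \<comment> \<open>Above \<open>x\<close>, the truncation of \<open>z\<close> is exact; below
    \<open>y\<close>, it is one unit short of the exact one.\<close>
  have "real_of_int (itrunc z (max k l)) = of_int (itrunc y (max k l))"
    using k[of "max k l"] l[of "max k l"] eq(2) by simp
  then show False using l[of "max k l"] by simp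
qed

lemma between_if_value_less:
  assumes "decimal_value x < decimal_value y"
  shows "\<exists>z. x < z \<and> z < y"
proof -
  obtain r where "decimal_value x < of_rat r" "of_rat r < decimal_value y"
    using of_rat_dense[OF assms] by blast
  then show ?thesis
    by (intro exI[of _ "decimal_of_rat r"])
      (simp add: decimal_less_if_value_less decimal_value_of_rat)
qed

lemma no_gap_iff: "no_gap x y \<longleftrightarrow> decimal_value x = decimal_value y"
proof
  assume "no_gap x y"
  then show "decimal_value x = decimal_value y"
    using between_if_value_less[of x y] between_if_value_less[of y x]
    unfolding no_gap_def by (metis linorder_less_linear order_less_irrefl)
next
  assume "decimal_value x = decimal_value y"
  then show "no_gap x y"
    using value_less_if_between[of x _ y] value_less_if_between[of y _ x]
    unfolding no_gap_def by auto
qed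

text \<open>A class is a fibre of \<open>decimal_value\<close>, and every decimal lies in its own
  fibre.\<close>

lemma gap_class_eq_iff: "gap_class x = gap_class y \<longleftrightarrow> decimal_value x = decimal_value y"
  by (auto simp: gap_class_def no_gap_iff set_eq_iff)

lemma lower_LIMIT_between:
  assumes "\<And>n. N \<le> n \<Longrightarrow> a \<le> x n" "\<And>n. N \<le> n \<Longrightarrow> x n \<le> b" "1 \<le> N"
  shows "a \<le> lower_LIMIT x" "lower_LIMIT x \<le> b"
proof -
  \<comment> \<open>The bound \<open>a\<close> says nothing about the terms before N. These are
    finitely many, so their minimum repairs it and every tail has a genuine infimum.\<close>
  have "Min (insert a (x ` {..N})) \<le> x n" for n
    using assms(1)[of n] by (cases "n \<le> N") (auto intro: Min_le min.coboundedI2 min.coboundedI1)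
  then have bdd: "bdd_below {x k | k. n \<le> k}" for n
    by (auto simp: bdd_below_def)
  have Inf_le: "Inf {x k | k. n \<le> k} \<le> b" for n
    \<comment> \<open>The term at \<open>max n N\<close> belongs to the tail from n and already
      obeys the bound \<open>b\<close>.\<close>
    by (rule cInf_lower2[of "x (max n N)"]) (auto simp: assms(2) bdd)
  show "lower_LIMIT x \<le> b"
    unfolding lower_LIMIT_def by (rule cSup_least) (auto simp: Inf_le)
  have "a \<le> Inf {x k | k. N \<le> k}"
    by (rule cInf_greatest) (auto simp: assms(1))
  also have "\<dots> \<le> lower_LIMIT x"
    unfolding lower_LIMIT_def using assms(3)
    by (intro cSup_upper bdd_aboveI[of _ b]) (auto simp: Inf_le)
  finally show "a \<le> lower_LIMIT x" .
qed

lemma tendsto_value_lower_LIMIT: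
  assumes "x \<in> CR"
  shows "(\<lambda>n. real_of_rat (x n)) \<longlonglongrightarrow> decimal_value (lower_LIMIT (\<lambda>n. decimal_of_rat (x n)))"
    (is "_ \<longlonglongrightarrow> decimal_value ?L")
proof (rule LIMSEQ_I)
  fix e :: real
  assume "0 < e"
  \<comment> \<open>The Cauchy condition takes rational tolerances only. Half of \<open>e\<close>
    suffices because both \<open>x n\<close> and the value of the lower limit are compared with
    \<open>x N\<close>, each at a cost of at most \<delta>.\<close>
  then obtain \<delta> where \<delta>: "0 < real_of_rat \<delta>" "real_of_rat \<delta> < e / 2"
    using of_rat_dense[of 0 "e / 2"] by auto
  then obtain N where "1 \<le> N" and N: "\<And>m n. N \<le> m \<Longrightarrow> N \<le> n \<Longrightarrow> \<bar>x m - x n\<bar> < \<delta>"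
    using assms unfolding CR_def by (auto simp: zero_less_of_rat_iff)
  have near: "x N - \<delta> < x n" "x n < x N + \<delta>" if "N \<le> n" for n
    using N[OF that order_refl] by auto
  have "decimal_of_rat (x N - \<delta>) \<le> ?L" "?L \<le> decimal_of_rat (x N + \<delta>)"
    using lower_LIMIT_between[of N "decimal_of_rat (x N - \<delta>)" "\<lambda>n. decimal_of_rat (x n)"
      "decimal_of_rat (x N + \<delta>)"] near \<open>1 \<le> N\<close>
    by (simp_all add: decimal_of_rat_strict_mono less_imp_le)
  from this[THEN decimal_value_mono]
  have L: "real_of_rat (x N) - of_rat \<delta> \<le> decimal_value ?L"
    "decimal_value ?L \<le> real_of_rat (x N) + of_rat \<delta>"
    by (simp_all add: decimal_value_of_rat of_rat_diff of_rat_add)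
  have "norm (real_of_rat (x n) - decimal_value ?L) < e" if "N \<le> n" for n
  proof -
    have "real_of_rat (x N - \<delta>) < of_rat (x n)" "real_of_rat (x n) < of_rat (x N + \<delta>)"
      using near[OF that] by (simp_all only: of_rat_less)
    then show ?thesis
      using L \<delta> by (simp add: of_rat_diff of_rat_add)
  qed
  then show "\<exists>N. \<forall>n\<ge>N. norm (real_of_rat (x n) - decimal_value ?L) < e" by blast
qed

text \<open>Rational tolerances are as good as real ones, since a positive rational lies below every
  positive real.\<close>

lemma seq_approx_iff_tendsto:
  "seq_approx x y \<longleftrightarrow> (\<lambda>n. real_of_rat (x n) - of_rat (y n)) \<longlonglongrightarrow> 0"
proof -
  have abs_less: "\<bar>real_of_rat a - of_rat b\<bar> < of_rat e \<longleftrightarrow> \<bar>a - b\<bar> < e" for a b e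
    by (simp add: abs_less_iff of_rat_less flip: of_rat_diff of_rat_minus)
  show ?thesis
  proof
    assume approx: "seq_approx x y"
    show "(\<lambda>n. real_of_rat (x n) - of_rat (y n)) \<longlonglongrightarrow> 0"
    proof (rule LIMSEQ_I)
      fix e :: real
      assume "0 < e"
      then obtain \<delta> where \<delta>: "0 < \<delta>" "real_of_rat \<delta> < e"
        using of_rat_dense[of 0 e] by auto
      then obtain N where "\<And>n. N \<le> n \<Longrightarrow> \<bar>x n - y n\<bar> < \<delta>"
        using approx unfolding seq_approx_def by blast
      then have "norm (real_of_rat (x n) - of_rat (y n) - 0) < e" if "N \<le> n" for n
        using that abs_less[of "x n" "y n" \<delta>] \<delta>(2) by fastforce
      then show "\<exists>N. \<forall>n\<ge>N. norm (real_of_rat (x n) - of_rat (y n) - 0) < e" by blast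
    qed
  next
    assume lim: "(\<lambda>n. real_of_rat (x n) - of_rat (y n)) \<longlonglongrightarrow> 0"
    show "seq_approx x y"
      unfolding seq_approx_def
    proof (intro allI impI)
      fix e :: rat
      assume "0 < e"
      then obtain N where N: "\<And>n. N \<le> n \<Longrightarrow> \<bar>real_of_rat (x n) - of_rat (y n)\<bar> < of_rat e"
        using LIMSEQ_D[OF lim, of "of_rat e"] by auto
      then show "\<exists>N\<ge>1. \<forall>n\<ge>N. \<bar>x n - y n\<bar> < e"
        \<comment> \<open>Indices start at 1 in \<open>seq_approx\<close>, whereas the threshold
          from the real limit may be 0.\<close>
        by (intro exI[of _ "max 1 N"]) (auto simp: abs_less)
    qed
  qed
qed

theorem theorem7p3:
  fixes x y :: "nat \<Rightarrow> rat"
  assumes "x \<in> CR" and "y \<in> CR"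
  shows "seq_approx x y \<longleftrightarrow> kappa x = kappa y"
proof -
  define u where "u = decimal_value (lower_LIMIT (\<lambda>n. decimal_of_rat (x n)))"
  define v where "v = decimal_value (lower_LIMIT (\<lambda>n. decimal_of_rat (y n)))"
  have "(\<lambda>n. real_of_rat (x n) - of_rat (y n)) \<longlonglongrightarrow> u - v"
    unfolding u_def v_def using assms by (intro tendsto_diff tendsto_value_lower_LIMIT)
  \<comment> \<open>The difference sequence has only one limit, so it tends to 0 exactly when
    \<open>u - v\<close> is 0.\<close>
  then have "seq_approx x y \<longleftrightarrow> u - v = 0"
    unfolding seq_approx_iff_tendsto by (metis LIMSEQ_unique)
  then show ?thesis
    by (simp add: kappa_def gap_class_eq_iff u_def v_def)
qed

end
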